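(* Let $n>6$ be an integer. If $1\neq\delta\in S_n$ is a $p$-cycle, where $p$ is a prime with $p\geq n-1$, then $v_\delta$ is an isolated vertex of the divisibility graph $D(S_n)$. All the other vertices of $D(S_n)$ (those not of the form $v_\delta$ with $\delta$ a $p$-cycle, $p\ge n-1$ prime) lie in a single connected component.
   Context: For a finite group $G$ and $g\in G$, let $g^G=\{x^{-1}gx : x\in G\}$ be the conjugacy class of $g$. The divisibility graph $D(G)$ is the graph whose vertex set is the set of integers $\{|g^G| : g\in G\}\setminus\{1\}$ (conjugacy class sizes different from $1$), where $a$ and $b$ are adjacent whenever $a$ divides $b$ or $b$ divides $a$. The vertex corresponding to $|g^G|$ is denoted $v_g$; thus $v_g=v_h$ whenever $|g^G|=|h^G|$. A vertex is isolated if it is not adjacent to any other vertex. $S_n$ is the symmetric group on $n$ points. *)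

theory Defs
  imports
    "HOL-Algebra.Sym_Groups"
    "HOL-Computational_Algebra.Primes"
    "Graph_Theory.Digraph_Component"
begin

definition conj_class :: "('a, 'b) monoid_scheme \<Rightarrow> 'a \<Rightarrow> 'a set" where
  "conj_class G g = {inv\<^bsub>G\<^esub> x \<otimes>\<^bsub>G\<^esub> g \<otimes>\<^bsub>G\<^esub> x | x. x \<in> carrier G}"

text \<open>This is the vertex \<open>v\<^sub>g\<close> of the divisibility graph when it differs from 1.\<close>

definition class_size :: "('a, 'b) monoid_scheme \<Rightarrow> 'a \<Rightarrow> nat" where
  "class_size G g = card (conj_class G g)"

text \<open>
  An undirected graph is represented, as usual in \<open>Graph_Theory\<close>, by a symmetric digraph: every
  edge is a pair of opposite arcs. Its connected components are then the members of
  \<^const>\<open>pre_digraph.sccs\<close>, and adjacency is \<^const>\<open>dominates\<close>.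
\<close>

definition divisibility_graph :: "('a, 'b) monoid_scheme \<Rightarrow> (nat, nat \<times> nat) pre_digraph" where
  "divisibility_graph G =
    (let V = class_size G ` carrier G - {1}
     in \<lparr> verts = V,
          arcs = {(a, b). a \<in> V \<and> b \<in> V \<and> a \<noteq> b \<and> (a dvd b \<or> b dvd a)},
          tail = fst,
          head = snd \<rparr>)"

lemma verts_divisibility_graph:
  "verts (divisibility_graph G) = class_size G ` carrier G - {1}"
  by (simp add: divisibility_graph_def Let_def)

lemma divisibility_graph_adjacent_iff:
  "a \<rightarrow>\<^bsub>divisibility_graph G\<^esub> b \<longleftrightarrow>
    a \<in> verts (divisibility_graph G) \<and> b \<in> verts (divisibility_graph G) \<and>
    a \<noteq> b \<and> (a dvd b \<or> b dvd a)"
  by (force simp: divisibility_graph_def Let_def arcs_ends_conv)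

lemma graph_divisibility_graph:
  assumes "finite (carrier G)"
  shows "graph (divisibility_graph G)"
proof -
  let ?D = "divisibility_graph G"
  have arcs: "arcs ?D \<subseteq> verts ?D \<times> verts ?D"
    and ends: "tail ?D = fst" "head ?D = snd"
    and fin: "finite (verts ?D)"
    using assms by (auto simp: divisibility_graph_def Let_def)
  have "finite (arcs ?D)"
    using arcs fin by (meson finite_SigmaI finite_subset)
  moreover have "symmetric ?D"
    unfolding symmetric_def by (rule symI) (auto simp: divisibility_graph_adjacent_iff)
  moreover have "tail ?D e \<noteq> head ?D e" if "e \<in> arcs ?D" for e
    using that by (auto simp: divisibility_graph_def Let_def)
  ultimately show ?thesis
    using arcs fin by unfold_locales (auto simp: ends arc_to_ends_def)
qed

definition isolated_vertex :: "('a, 'b) pre_digraph \<Rightarrow> 'a \<Rightarrow> bool" where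
  "isolated_vertex G v \<longleftrightarrow> v \<in> verts G \<and> (\<forall>w \<in> verts G. w \<noteq> v \<longrightarrow> \<not> v \<rightarrow>\<^bsub>G\<^esub> w)"

text \<open>Lists of length at most 1 give the identity, so this is meaningful only for \<open>k \<ge> 2\<close>.\<close>

definition is_cycle_of_length :: "nat \<Rightarrow> ('a \<Rightarrow> 'a) \<Rightarrow> bool" where
  "is_cycle_of_length k \<sigma> \<longleftrightarrow> (\<exists>cs. distinct cs \<and> length cs = k \<and> \<sigma> = cycle_of_list cs)"

end

theory Submission
  imports
    Defs
    "HOL-Algebra.Group_Action"
    "HOL-Algebra.Sylow"
    "HOL-Algebra.Multiplicative_Group"
    "HOL-Number_Theory.Cong"
begin

text \<open>
  By the orbit-stabilizer theorem the class size of \<open>g\<close> is \<open>n!\<close> divided by the order of the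
  centralizer \<open>C(g)\<close>, so divisibility between class sizes is reversed divisibility between
  centralizer orders (\<open>class_size_dvd_iff\<close>).

  \<^bold>\<open>Isolated vertices.\<close> Let \<open>z\<close> have prime order \<open>p \<ge> n - 1\<close>. At most one point lies outside a
  nontrivial orbit of \<open>z\<close>, so a permutation commuting with \<open>z\<close> is a power of \<open>z\<close>, and \<open>C(z)\<close>
  has order \<open>p\<close>. If the class size of some \<open>g \<noteq> 1\<close> is comparable with that of \<open>z\<close>, then \<open>p\<close> divides
  the order of \<open>C(g)\<close>: the order of \<open>C(g)\<close> either divides \<open>p\<close>, and it is not 1, or is a
  multiple of \<open>p\<close>. By Cauchy's theorem \<open>g\<close> commutes with an element of order \<open>p\<close>; hence \<open>g\<close> is a
  power of that element, it has order \<open>p\<close> itself, and its class has the same size as that of \<open>z\<close>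
  (\<open>class_size_long_cycle_comparable_imp_eq\<close>).

  \<^bold>\<open>Connectedness.\<close> A power \<open>g\<^sup>k \<noteq> 1\<close> has a class size dividing that of \<open>g\<close>, so every vertex is
  joined to that of an element \<open>z\<close> of prime order \<open>p\<close>. If \<open>g\<close> and \<open>h\<close> commute and have coprime
  orders, both are powers of \<open>gh\<close>, so their vertices are joined through the one of \<open>gh\<close>
  (\<open>linked_if_commute_coprime\<close>). These moves nearly suffice to reach the transposition \<open>(1 2)\<close>:

  \<^item> Two transpositions are both disjoint from a common 3-cycle, because \<open>n \<ge> 7\<close>; and a 3-cycle is
    disjoint from some transposition.

  \<^item> If \<open>p\<close> is odd and \<open>z\<close> fixes two points, it commutes with the transposition of them.

  \<^item> If \<open>p\<close> is odd and \<open>z\<close> has two nontrivial orbits, it commutes with an involution that swaps them.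

  \<^item> An involution with three fixed points commutes with a 3-cycle on them; any other one has three
    2-cycles, as \<open>n \<ge> 7\<close>, and commutes with a product of two 3-cycles that permutes
    these 2-cycles cyclically.

  \<^item> If none of this applies, \<open>z\<close> is a \<open>p\<close>-cycle with \<open>p \<ge> n - 1\<close>. Then \<open>g\<close> is a power
    of \<open>z\<close> by the first part, and its vertex is one of the excluded ones.

  What remains is the product \<open>ab\<close> of two disjoint 3-cycles. For \<open>n = 7\<close> the elements of coprime
  order commuting with it only lead back to involutions with three 2-cycles. But the class size
  of \<open>a\<close> divides that of \<open>ab\<close> although \<open>C(ab)\<close> is not contained in \<open>C(a)\<close>: the subgroup
  \<open>C(a) \<inter> C(b)\<close> has index 2 in \<open>C(ab)\<close> and even index in \<open>C(a)\<close>
  (\<open>class_size_dvd_of_swapped_factors\<close>).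
\<close>

section \<open>Class sizes and centralizers\<close>

definition centralizer :: "('a, 'b) monoid_scheme \<Rightarrow> 'a \<Rightarrow> 'a set" where
  "centralizer G g = {x \<in> carrier G. x \<otimes>\<^bsub>G\<^esub> g = g \<otimes>\<^bsub>G\<^esub> x}"

lemma (in group) conj_eq_iff:
  assumes "x \<in> carrier G" "g \<in> carrier G" "h \<in> carrier G"
  shows "x \<otimes> g \<otimes> inv x = h \<longleftrightarrow> x \<otimes> g = h \<otimes> x"
  using assms by (metis inv_solve_right m_closed)

lemma (in group) subgroup_centralizer:
  assumes g: "g \<in> carrier G"
  shows "subgroup (centralizer G g) G"
proof (rule subgroupI)
  show "centralizer G g \<noteq> {}"
    using g unfolding centralizer_def by (auto intro!: exI[of _ \<one>])
next
  fix x y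
  assume "x \<in> centralizer G g" "y \<in> centralizer G g"
  then have x: "x \<in> carrier G" "x \<otimes> g = g \<otimes> x" and y: "y \<in> carrier G" "y \<otimes> g = g \<otimes> y"
    by (auto simp: centralizer_def)
  show "x \<otimes> y \<in> centralizer G g"
    unfolding centralizer_def using x y g by (auto simp: m_assoc) (metis m_assoc)
next
  fix x
  assume "x \<in> centralizer G g"
  then have x: "x \<in> carrier G" "x \<otimes> g = g \<otimes> x"
    by (auto simp: centralizer_def)
  then show "inv x \<in> centralizer G g"
    unfolding centralizer_def using g conj_eq_iff[of "inv x" g g]
    by (auto simp: m_assoc) (metis inv_solve_left' m_assoc m_closed)
qed (auto simp: centralizer_def)

text \<open>
  The orbit-stabilizer theorem for a subgroup acting by conjugation. The acting subgroup is kept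
  general because the comparison of two centralizers below lets each of them act.
\<close>

lemma (in group) card_conjugates_mult_card_fixers:
  assumes H: "subgroup H G" and b: "b \<in> carrier G"
  shows "card {x \<otimes> b \<otimes> inv x | x. x \<in> H} * card (H \<inter> centralizer G b) = card H"
proof -
  let ?act = "\<lambda>g. \<lambda>h \<in> carrier G. g \<otimes> h \<otimes> inv g"
  interpret conj: group_action "G\<lparr>carrier := H\<rparr>" "carrier G" ?act
    by (rule group_action.induced_action[OF action_by_conjugation H])
  have HG: "H \<subseteq> carrier G"
    using H by (rule subgroup.subset)
  have "orbit (G\<lparr>carrier := H\<rparr>) ?act b = {x \<otimes> b \<otimes> inv x | x. x \<in> H}"
    using b by (auto simp: orbit_def)
  moreover have "stabilizer (G\<lparr>carrier := H\<rparr>) ?act b = H \<inter> centralizer G b"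
    using b HG conj_eq_iff[OF _ b b] by (auto simp: stabilizer_def centralizer_def)
  ultimately show ?thesis
    using conj.orbit_stabilizer_theorem[OF b] by (simp add: order_def)
qed

lemma (in group) class_size_mult_card_centralizer:
  assumes g: "g \<in> carrier G"
  shows "class_size G g * card (centralizer G g) = order G"
proof -
  \<comment> \<open>Conjugating by \<open>x\<close> or by its inverse gives the same class, as \<open>x\<close> runs over the whole group.\<close>
  have "conj_class G g = {x \<otimes> g \<otimes> inv x | x. x \<in> carrier G}"
    unfolding conj_class_def by (auto, metis inv_closed inv_inv, metis inv_closed inv_inv)
  moreover have "carrier G \<inter> centralizer G g = centralizer G g"
    by (auto simp: centralizer_def)
  ultimately show ?thesis
    using card_conjugates_mult_card_fixers[OF subgroup_self g] by (simp add: class_size_def order_def)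
qed

lemma (in group) class_size_dvd_iff:
  assumes fin: "finite (carrier G)" and g: "g \<in> carrier G" and h: "h \<in> carrier G"
  shows "class_size G g dvd class_size G h \<longleftrightarrow> card (centralizer G h) dvd card (centralizer G g)"
proof -
  have "order G > 0"
    using fin order_gt_0_iff_finite by blast
  moreover have "class_size G g * card (centralizer G g) = class_size G h * card (centralizer G h)"
    using class_size_mult_card_centralizer g h by simp
  moreover have "a dvd c \<longleftrightarrow> d dvd b" if "a * b = c * d" "a * b > 0" for a b c d :: nat
  proof
    assume "a dvd c"
    then obtain k where "c = a * k" ..
    then show "d dvd b"
      using that by auto
  next
    assume "d dvd b"
    then obtain k where "b = d * k" ..
    then show "a dvd c"
      using that by auto
  qed
  ultimately show ?thesis
    using class_size_mult_card_centralizer[OF g] by metis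
qed

lemma (in group) class_size_dvd_if_centralizer_subset:
  assumes fin: "finite (carrier G)" and g: "g \<in> carrier G" and h: "h \<in> carrier G"
    and sub: "centralizer G h \<subseteq> centralizer G g"
  shows "class_size G g dvd class_size G h"
proof -
  interpret C: group "G\<lparr>carrier := centralizer G g\<rparr>"
    by (rule subgroup_imp_group[OF subgroup_centralizer[OF g]])
  have "subgroup (centralizer G h) (G\<lparr>carrier := centralizer G g\<rparr>)"
    by (rule subgroup_incl[OF subgroup_centralizer[OF h] subgroup_centralizer[OF g] sub])
  from C.lagrange[OF this] show ?thesis
    unfolding class_size_dvd_iff[OF fin g h] by (metis dvd_triv_right order_def partial_object.simps(3) partial_object.select_convs(1) partial_object.surjective)
qed

lemma (in group) centralizer_subset_pow:
  assumes "g \<in> carrier G"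
  shows "centralizer G g \<subseteq> centralizer G (g [^] (k :: nat))"
  unfolding centralizer_def using assms group_commutes_pow[of g _ k] by auto

lemma (in group) class_size_pow_dvd:
  assumes "finite (carrier G)" and "g \<in> carrier G"
  shows "class_size G (g [^] (k :: nat)) dvd class_size G g"
  using assms by (intro class_size_dvd_if_centralizer_subset centralizer_subset_pow) auto

text \<open>
  By the Chinese remainder theorem \<open>g\<close> is a power of \<open>g \<otimes> h\<close>: an exponent that is a multiple
  of \<open>q\<close> and congruent to 1 modulo \<open>p\<close> kills \<open>h\<close> and keeps \<open>g\<close>.
\<close>

lemma (in group) class_size_dvd_coprime_mult:
  assumes fin: "finite (carrier G)" and g: "g \<in> carrier G" and h: "h \<in> carrier G"
    and comm: "g \<otimes> h = h \<otimes> g"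
    and p: "g [^] (p :: nat) = \<one>" and q: "h [^] (q :: nat) = \<one>" and "coprime p q"
  shows "class_size G g dvd class_size G (g \<otimes> h)"
proof -
  from \<open>coprime p q\<close> have "coprime q p"
    by (simp add: coprime_commute)
  then obtain k where k: "[q * k = 1] (mod p)"
    using cong_solve_coprime_nat[of q p] by auto
  have "(g \<otimes> h) [^] (q * k) = g [^] (q * k) \<otimes> h [^] (q * k)"
    using comm g h by (rule pow_mult_distrib)
  also have "h [^] (q * k) = \<one>"
    using h q by (metis nat_pow_pow nat_pow_one)
  also have "g [^] (q * k) = g [^] (1 :: nat)"
  proof -
    have "int (ord g) dvd int p"
      using p g by (simp add: pow_eq_id)
    then have "int (ord g) dvd int (q * k) - int 1"
      using k by (metis cong_iff_dvd_diff cong_int_iff dvd_trans)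
    then show ?thesis
      using int_pow_eq[OF g, of "int 1" "int (q * k)"] by (metis int_pow_int)
  qed
  finally have "(g \<otimes> h) [^] (q * k) = g"
    using g by simp
  then show ?thesis
    using class_size_pow_dvd[OF fin, of "g \<otimes> h" "q * k"] g h by simp
qed

text \<open>
  Sylow's existence theorem for the first power of \<open>p\<close> gives a subgroup of order \<open>p\<close>; any
  nontrivial element of it will do.
\<close>

lemma (in group) Cauchy:
  assumes fin: "finite (carrier G)" and p: "prime p" and dvd: "p dvd order G"
  obtains z where "z \<in> carrier G" "z \<noteq> \<one>" "z [^] p = \<one>"
proof -
  obtain m where "order G = p ^ 1 * m"
    using dvd by auto
  from sylow_thm[OF p is_group this fin]
  obtain H where H: "subgroup H G" "card H = p" by auto
  interpret H: group "G\<lparr>carrier := H\<rparr>"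
    by (rule subgroup_imp_group[OF H(1)])
  have "1 < card H"
    using p H(2) prime_gt_1_nat by simp
  then obtain z where z: "z \<in> H" "z \<noteq> \<one>"
    by (metis One_nat_def card.empty card.insert card_mono finite.emptyI finite_insert insertCI
        not_less subsetI equals0D)
  have "z [^]\<^bsub>G\<lparr>carrier := H\<rparr>\<^esub> p = \<one>"
    using H.pow_order_eq_1[of z] z H(2) by (simp add: order_def)
  then have "z [^] p = \<one>"
    by (simp flip: nat_pow_consistent)
  then show thesis
    using that z subgroup.subset[OF H(1)] by blast
qed

lemma (in group) Cauchy_centralizer:
  assumes fin: "finite (carrier G)" and p: "prime p" and g: "g \<in> carrier G"
    and dvd: "p dvd card (centralizer G g)"
  obtains z where "z \<in> centralizer G g" "z \<noteq> \<one>" "z [^] p = \<one>"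
proof -
  interpret C: group "G\<lparr>carrier := centralizer G g\<rparr>"
    by (rule subgroup_imp_group[OF subgroup_centralizer[OF g]])
  have "finite (centralizer G g)"
    using fin by (simp add: centralizer_def)
  then show thesis
    using C.Cauchy[of p] p dvd that nat_pow_consistent by (auto simp: order_def)
qed

lemma even_card_fixpoint_free_involution:
  assumes "finite X" and "\<And>x. x \<in> X \<Longrightarrow> f x \<in> X" and "\<And>x. x \<in> X \<Longrightarrow> f (f x) = x"
    and "\<And>x. x \<in> X \<Longrightarrow> f x \<noteq> x"
  shows "even (card X)"
  using assms
proof (induction "card X" arbitrary: X rule: less_induct)
  case less
  show ?case
  proof (cases "X = {}")
    case False
    then obtain x where x: "x \<in> X" by blast
    let ?Y = "X - {x, f x}"
    have sub: "{x, f x} \<subseteq> X"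
      using less.prems x by auto
    moreover have "card {x, f x} = 2"
      using less.prems(4)[OF x] by simp
    ultimately have card: "card X = card ?Y + 2"
      using less.prems(1) by (metis card_Diff_subset card_mono finite_subset le_add_diff_inverse2)
    have "even (card ?Y)"
    proof (rule less.hyps)
      show "card ?Y < card X" using card by simp
      show "finite ?Y" using less.prems(1) by simp
      show "f y \<in> ?Y" if "y \<in> ?Y" for y
        using that less.prems(2,3) x by (metis Diff_iff insert_iff singletonD insertCI empty_iff)
    qed (use less.prems in auto)
    then show ?thesis using card by simp
  qed simp
qed

text \<open>
  Write \<open>L = C(a) \<inter> C(b)\<close>. The group \<open>C(a \<otimes> b)\<close> permutes \<open>a\<close> and \<open>b\<close> transitively by
  conjugation and the stabilizer of \<open>a\<close> is \<open>L\<close>, so it has order \<open>2 |L|\<close>. The \<open>C(a)\<close>-conjugates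
  of \<open>b\<close> are closed under inversion because \<open>t\<close> inverts \<open>b\<close>, and none of them is its own inverse;
  their number is therefore even, and it is the index of \<open>L\<close> in \<open>C(a)\<close>. So \<open>2 |L|\<close> divides the
  order of \<open>C(a)\<close>.
\<close>

lemma (in group) class_size_dvd_of_swapped_factors:
  assumes fin: "finite (carrier G)" and a: "a \<in> carrier G" and b: "b \<in> carrier G"
    and comm: "a \<otimes> b = b \<otimes> a" and "a \<noteq> b" and "b \<otimes> b \<noteq> \<one>"
    and s: "s \<in> carrier G" "s \<otimes> a = b \<otimes> s" "s \<otimes> b = a \<otimes> s"
    and t: "t \<in> carrier G" "t \<otimes> a = a \<otimes> t" "t \<otimes> b = inv b \<otimes> t"
    and factors: "\<And>h. h \<in> centralizer G (a \<otimes> b) \<Longrightarrow> h \<otimes> a \<otimes> inv h \<in> {a, b}"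
  shows "class_size G a dvd class_size G (a \<otimes> b)"
proof -
  let ?H = "centralizer G (a \<otimes> b)" and ?K = "centralizer G a"
  let ?L = "centralizer G a \<inter> centralizer G b"
  have ab: "a \<otimes> b \<in> carrier G"
    using a b by simp
  have HK: "?H \<inter> centralizer G a = ?L"
  proof -
    have "x \<otimes> (a \<otimes> b) = (a \<otimes> b) \<otimes> x \<longleftrightarrow> x \<otimes> b = b \<otimes> x"
      if "x \<in> carrier G" "x \<otimes> a = a \<otimes> x" for x
      using that a b by (metis m_assoc m_closed Units_eq Units_l_cancel)
    then show ?thesis
      by (auto simp: centralizer_def)
  qed
  have sH: "s \<in> ?H"
    using s a b comm by (auto simp: centralizer_def) (metis m_assoc)
  have "{x \<otimes> a \<otimes> inv x | x. x \<in> ?H} = {a, b}"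
  proof
    show "{x \<otimes> a \<otimes> inv x | x. x \<in> ?H} \<subseteq> {a, b}"
      using factors by auto
    have "\<one> \<in> ?H" "a = \<one> \<otimes> a \<otimes> inv \<one>"
      using a ab by (simp_all add: centralizer_def)
    then have "\<exists>x. a = x \<otimes> a \<otimes> inv x \<and> x \<in> ?H" by (intro exI conjI)
    moreover have "b = s \<otimes> a \<otimes> inv s"
      using s conj_eq_iff[OF s(1) a b] by simp
    with sH have "\<exists>x. b = x \<otimes> a \<otimes> inv x \<and> x \<in> ?H" by (intro exI conjI)
    ultimately show "{a, b} \<subseteq> {x \<otimes> a \<otimes> inv x | x. x \<in> ?H}" by simp
  qed
  then have cardH: "card ?H = 2 * card ?L"
    using card_conjugates_mult_card_fixers[OF subgroup_centralizer[OF ab] a] \<open>a \<noteq> b\<close> HK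
    by (simp add: card_2_iff)
  let ?B = "{x \<otimes> b \<otimes> inv x | x. x \<in> ?K}"
  have K: "subgroup ?K G"
    by (rule subgroup_centralizer[OF a])
  then have KG: "x \<in> carrier G" if "x \<in> ?K" for x
    using that by (simp add: centralizer_def)
  have inv_conj: "inv (x \<otimes> b \<otimes> inv x) = x \<otimes> inv b \<otimes> inv x" if "x \<in> carrier G" for x
    using that b by (simp add: inv_mult_group m_assoc)
  have "even (card ?B)"
  proof (rule even_card_fixpoint_free_involution[where f = "m_inv G"])
    have "finite ?K"
      using fin by (simp add: centralizer_def)
    then show "finite ?B" by simp
  next
    fix y assume "y \<in> ?B"
    then obtain x where x: "x \<in> ?K" "y = x \<otimes> b \<otimes> inv x" by blast
    have "t \<in> ?K"
      using t by (simp add: centralizer_def)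
    then have "x \<otimes> t \<in> ?K"
      using x(1) K by (simp add: subgroup.m_closed)
    moreover have "t \<otimes> b \<otimes> inv t = inv b"
      using t conj_eq_iff[OF t(1) b inv_closed[OF b]] by simp
    then have "(x \<otimes> t) \<otimes> b \<otimes> inv (x \<otimes> t) = x \<otimes> inv b \<otimes> inv x"
      using KG[OF x(1)] b t(1) by (simp add: inv_mult_group) (metis inv_closed m_assoc m_closed)
    ultimately show "inv y \<in> ?B"
      using x inv_conj[OF KG[OF x(1)]] by (auto intro!: exI[of _ "x \<otimes> t"])
    have y: "y \<in> carrier G"
      using x KG b by simp
    then show "inv (inv y) = y" by simp
    show "inv y \<noteq> y"
    proof
      assume "inv y = y"
      then have "x \<otimes> inv b \<otimes> inv x = x \<otimes> b \<otimes> inv x"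
        using inv_conj x KG by simp
      then have "inv b = b"
        using KG[OF x(1)] b by simp
      then show False
        using \<open>b \<otimes> b \<noteq> \<one>\<close> b by (metis r_inv)
    qed
  qed
  then have "2 * card ?L dvd card ?K"
    using card_conjugates_mult_card_fixers[OF K b] mult_dvd_mono[OF _ dvd_refl, of 2 "card ?B" "card ?L"]
    by simp
  then show ?thesis
    using cardH class_size_dvd_iff[OF fin a ab] by simp
qed

section \<open>Permutations of prime order\<close>

interpretation sym: group "sym_group n" for n
  by (rule sym_group_is_group)

lemma sym_group_simps [simp]:
  "x \<otimes>\<^bsub>sym_group n\<^esub> y = x \<circ> y" "\<one>\<^bsub>sym_group n\<^esub> = id"
  "x [^]\<^bsub>sym_group n\<^esub> (k :: nat) = x ^^ k"
proof -
  show 1: "x \<otimes>\<^bsub>sym_group n\<^esub> y = x \<circ> y" for x y and n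
    by (simp add: sym_group_mult)
  show 2: "\<one>\<^bsub>sym_group n\<^esub> = id" for n
    by (simp add: sym_group_one)
  show "x [^]\<^bsub>sym_group n\<^esub> (k :: nat) = x ^^ k"
    by (induction k) (simp_all add: 1 2 funpow_Suc_right del: funpow.simps(2))
qed

lemma finite_sym_group [simp]: "finite (carrier (sym_group n))"
  by (simp add: sym_group_def finite_permutations)

lemma sym_group_permutation:
  assumes "z \<in> carrier (sym_group n)"
  shows "bij z" "inj z" "permutation z"
  using assms sym_group_carrier[of z n] permutes_bij permutes_inj sym_group_carrier' by blast+

lemma mem_sym_centralizer_iff:
  "h \<in> centralizer (sym_group n) g \<longleftrightarrow> h permutes {1..n} \<and> h \<circ> g = g \<circ> h"
  by (simp add: centralizer_def sym_group_carrier)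

text \<open>
  The orbit of \<open>x\<close> has a length that divides the prime \<open>p\<close> and is not 1.
\<close>

lemma funpow_eq_iff_mod_prime:
  assumes z: "permutation z" and p: "prime p" "z ^^ p = id" and x: "z x \<noteq> x"
  shows "(z ^^ i) x = (z ^^ j) x \<longleftrightarrow> i mod p = j mod p"
proof -
  have "least_power z x dvd p"
    using least_power_dvd[OF z] p(2) by simp
  moreover have "least_power z x \<noteq> 1"
    using least_power_of_permutation(1)[OF z, of x] x by auto
  ultimately have least: "least_power z x = p"
    using p(1) prime_nat_iff by auto
  have inj: "inj z"
    using z permutation by (simp add: permutation bij_is_inj)
  have le: "p dvd j - i" if "(z ^^ i) x = (z ^^ j) x" "i \<le> j" for i j
    using funpow_diff[OF inj that(2,1)] least_power_dvd[OF z, of x "j - i"] least by simp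
  have mod: "(z ^^ (i mod p)) x = (z ^^ i) x" for i
    using p(2) by (simp add: funpow_mod_eq)
  show ?thesis
  proof
    assume eq: "(z ^^ i) x = (z ^^ j) x"
    show "i mod p = j mod p"
    proof (cases "i \<le> j")
      case True
      then show ?thesis
        using le[OF eq] mod_eq_dvd_iff_nat[of i j p] by simp
    next
      case False
      then show ?thesis
        using le[OF eq[symmetric]] mod_eq_dvd_iff_nat[of j i p] by simp
    qed
  next
    assume "i mod p = j mod p"
    then show "(z ^^ i) x = (z ^^ j) x"
      using mod by metis
  qed
qed

abbreviation funpow_orbit :: "('a \<Rightarrow> 'a) \<Rightarrow> 'a \<Rightarrow> 'a set" where
  "funpow_orbit z x \<equiv> range (\<lambda>i. (z ^^ i) x)"

lemma funpow_orbit_prime: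
  assumes z: "permutation z" and p: "prime p" "z ^^ p = id" and x: "z x \<noteq> x"
  shows "funpow_orbit z x = (\<lambda>i. (z ^^ i) x) ` {..<p}" "card (funpow_orbit z x) = p"
proof -
  note iff = funpow_eq_iff_mod_prime[OF assms]
  have "p > 0"
    using p(1) prime_gt_0_nat by simp
  show eq: "funpow_orbit z x = (\<lambda>i. (z ^^ i) x) ` {..<p}"
  proof
    show "funpow_orbit z x \<subseteq> (\<lambda>i. (z ^^ i) x) ` {..<p}"
    proof clarify
      fix i
      have "(z ^^ i) x = (z ^^ (i mod p)) x"
        using iff by simp
      then show "(z ^^ i) x \<in> (\<lambda>i. (z ^^ i) x) ` {..<p}"
        using \<open>p > 0\<close> by (intro image_eqI[of _ _ "i mod p"]) auto
    qed
  qed auto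
  have "inj_on (\<lambda>i. (z ^^ i) x) {..<p}"
    using iff by (auto simp: inj_on_def)
  then show "card (funpow_orbit z x) = p"
    unfolding eq by (simp add: card_image)
qed

lemma funpow_orbit_subset:
  assumes "z permutes S" "x \<in> S"
  shows "funpow_orbit z x \<subseteq> S"
  using permutes_in_image[OF permutes_funpow[OF assms(1)]] assms(2) by blast

lemma moved_in_permutes: "z permutes S \<Longrightarrow> z x \<noteq> x \<Longrightarrow> x \<in> S"
  by (auto simp: permutes_def)

lemma funpow_orbit_moved:
  assumes "inj z" and x: "z x \<noteq> x" and y: "y \<in> funpow_orbit z x"
  shows "z y \<noteq> y"
proof -
  obtain i where i: "y = (z ^^ i) x"
    using y by blast
  have "z y = (z ^^ i) (z x)"
    unfolding i by (metis comp_apply funpow_swap1)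
  then show ?thesis
    using i x inj_fn[OF \<open>inj z\<close>, of i] by (simp add: inj_eq)
qed

lemma funpow_comm_apply:
  assumes "h \<circ> z = z \<circ> h"
  shows "h ((z ^^ i) x) = (z ^^ i) (h x)"
proof (induction i)
  case (Suc i)
  then show ?case
    using fun_cong[OF assms, of "(z ^^ i) x"] by simp
qed simp

text \<open>
  The orbit \<open>O\<close> of a moved point \<open>x\<close> has \<open>p\<close> elements, so at most one point of \<open>S\<close> lies outside
  it, and that point has nowhere to go: \<open>O\<close> is exactly the set of points moved by \<open>z\<close>. As \<open>h\<close>
  commutes with \<open>z\<close>, it preserves \<open>O\<close>. So \<open>h x = (z ^^ i) x\<close> for some \<open>i\<close>; then \<open>h\<close> agrees with
  \<open>z ^^ i\<close> on all of \<open>O\<close>, and both fix the remaining point.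
\<close>

lemma commuting_with_long_cycle_is_power:
  assumes S: "finite S" "card S \<le> p + 1" and z: "z permutes S" and p: "prime p" "z ^^ p = id"
    and "z \<noteq> id" and h: "h permutes S" and comm: "h \<circ> z = z \<circ> h"
  shows "\<exists>i<p. h = z ^^ i"
proof -
  have perm: "permutation z" and inj: "inj z"
    using z S(1) permutation_permutes permutes_inj by blast+
  obtain x where x: "z x \<noteq> x"
    using \<open>z \<noteq> id\<close> by (auto simp: fun_eq_iff)
  let ?O = "funpow_orbit z x"
  note orbit = funpow_orbit_prime[OF perm p x]
  have OS: "?O \<subseteq> S"
    by (rule funpow_orbit_subset[OF z moved_in_permutes[OF z x]])
  have moved_iff: "z y \<noteq> y \<longleftrightarrow> y \<in> ?O" for y
  proof
    assume y: "z y \<noteq> y"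
    show "y \<in> ?O"
    proof (rule ccontr)
      assume "y \<notin> ?O"
      have "z y \<notin> ?O"
      proof
        assume "z y \<in> ?O"
        then obtain i where "z y = (z ^^ i) x" by blast
        moreover have "(z ^^ (p - 1)) (z y) = y"
          using p prime_gt_0_nat[OF p(1)] by (metis Suc_diff_1 comp_apply funpow_Suc_right id_apply)
        ultimately have "y = (z ^^ (p - 1 + i)) x"
          by (simp add: funpow_add)
        then show False
          using \<open>y \<notin> ?O\<close> by blast
      qed
      moreover have "y \<in> S" "z y \<in> S"
        using moved_in_permutes[OF z y] permutes_in_image[OF z] by auto
      ultimately have "{y, z y} \<subseteq> S - ?O"
        using \<open>y \<notin> ?O\<close> by (simp only: insert_subset Diff_iff empty_subsetI simp_thms)
      then have "card {y, z y} \<le> card (S - ?O)"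
        using S(1) by (simp add: card_mono)
      moreover have "card (S - ?O) \<le> 1"
        using S OS orbit(2) by (simp add: card_Diff_subset finite_subset)
      ultimately show False
        using y by simp
    qed
  qed (rule funpow_orbit_moved[OF inj x])
  have "h x \<in> ?O"
    using x fun_cong[OF comm, of x] permutes_inj[OF h] moved_iff by (metis comp_apply injD)
  then obtain i where i: "i < p" "h x = (z ^^ i) x"
    using orbit(1) by auto
  have "h y = (z ^^ i) y" for y
  proof (cases "y \<in> ?O")
    case True
    then obtain j where j: "y = (z ^^ j) x" by blast
    have "h y = (z ^^ (j + i)) x"
      using funpow_comm_apply[OF comm] i j by (simp add: funpow_add)
    then show ?thesis
      using j by (simp add: funpow_add add.commute)
  next
    case False
    then have fix_y: "z y = y"
      using moved_iff by blast
    then have "h y \<notin> ?O"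
      using moved_iff[of "h y"] fun_cong[OF comm, of y] by simp
    have pow: "(z ^^ i) y = y"
      using fix_y by (induction i) auto
    have "h y = y"
    proof (cases "y \<in> S")
      case True
      then have "h y \<in> S"
        using permutes_in_image[OF h] by simp
      moreover have "card (S - ?O) \<le> 1"
        using S OS orbit(2) by (simp add: card_Diff_subset finite_subset)
      ultimately show ?thesis
        using \<open>h y \<notin> ?O\<close> False True S(1) by (auto dest!: card_le_Suc0_iff_eq[THEN iffD1, rotated])
    qed (use h in \<open>auto simp: permutes_def\<close>)
    then show ?thesis
      using pow by simp
  qed
  then show ?thesis
    using i(1) by blast
qed

lemma card_centralizer_long_cycle:
  assumes p: "prime p" "n \<le> p + 1" and z: "z \<in> carrier (sym_group n)" "z \<noteq> id" "z ^^ p = id"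
  shows "card (centralizer (sym_group n) z) = p"
proof -
  obtain x where x: "z x \<noteq> x"
    using z(2) by (auto simp: fun_eq_iff)
  have z': "z permutes {1..n}"
    using z(1) by (simp add: sym_group_carrier)
  have "centralizer (sym_group n) z = (\<lambda>i. z ^^ i) ` {..<p}"
  proof
    show "centralizer (sym_group n) z \<subseteq> (\<lambda>i. z ^^ i) ` {..<p}"
    proof
      fix h
      assume "h \<in> centralizer (sym_group n) z"
      then have "\<exists>i<p. h = z ^^ i"
        using commuting_with_long_cycle_is_power[OF _ _ z' p(1) z(3,2)] p(2)
        by (simp add: mem_sym_centralizer_iff)
      then show "h \<in> (\<lambda>i. z ^^ i) ` {..<p}" by blast
    qed
    show "(\<lambda>i. z ^^ i) ` {..<p} \<subseteq> centralizer (sym_group n) z"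
      using permutes_funpow[OF z'] by (auto simp: mem_sym_centralizer_iff fun_eq_iff funpow_swap1)
  qed
  moreover have "inj_on (\<lambda>i. z ^^ i) {..<p}"
    using funpow_eq_iff_mod_prime[OF sym_group_permutation(3)[OF z(1)] p(1) z(3) x]
    by (auto simp: inj_on_def dest!: fun_cong[of _ _ x])
  ultimately show ?thesis
    by (simp add: card_image)
qed

text \<open>
  The centre of the symmetric group is trivial: if \<open>g\<close> moves \<open>x\<close>, it does not commute with a
  transposition that moves \<open>g x\<close> but fixes \<open>x\<close>.
\<close>

lemma class_size_eq_1_iff:
  assumes n: "n \<ge> 3" and g: "g \<in> carrier (sym_group n)"
  shows "class_size (sym_group n) g = 1 \<longleftrightarrow> g = id"
proof
  assume "class_size (sym_group n) g = 1"
  then have "card (centralizer (sym_group n) g) = card (carrier (sym_group n))"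
    using sym.class_size_mult_card_centralizer[OF g] by (simp add: order_def)
  then have "centralizer (sym_group n) g = carrier (sym_group n)"
    by (intro card_subset_eq) (auto simp: centralizer_def)
  then have comm: "h \<circ> g = g \<circ> h" if "h permutes {1..n}" for h
    using that mem_sym_centralizer_iff[of h n g] by (simp add: sym_group_carrier)
  show "g = id"
  proof (rule ccontr)
    assume "g \<noteq> id"
    then obtain x where x: "g x \<noteq> x"
      by (auto simp: fun_eq_iff)
    have g': "g permutes {1..n}"
      using g by (simp add: sym_group_carrier)
    have mem: "x \<in> {1..n}" "g x \<in> {1..n}"
      using moved_in_permutes[OF g' x] permutes_in_image[OF g'] by auto
    have "card ({1..n} - {x, g x}) \<noteq> 0"
      using n mem x by (simp add: card_Diff_subset)
    then obtain y where y: "y \<in> {1..n}" "y \<noteq> x" "y \<noteq> g x"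
      by (metis Diff_iff card.empty equals0I insertCI)
    have "transpose (g x) y (g x) = g (transpose (g x) y x)"
      using comm[OF permutes_swap_id[OF mem(2) y(1)]] by (metis comp_apply)
    then show False
      using x y by simp
  qed
next
  assume "g = id"
  then have "centralizer (sym_group n) g = carrier (sym_group n)"
    by (auto simp: centralizer_def)
  then show "class_size (sym_group n) g = 1"
    using sym.class_size_mult_card_centralizer[OF g] by (simp add: order_def sym_group_card_carrier)
qed

lemma mem_verts_iff:
  assumes n: "n \<ge> 3" and g: "g \<in> carrier (sym_group n)"
  shows "class_size (sym_group n) g \<in> verts (divisibility_graph (sym_group n)) \<longleftrightarrow> g \<noteq> id"
  using class_size_eq_1_iff[OF assms] g by (auto simp: verts_divisibility_graph)

text \<open>
  In both cases \<open>p\<close> divides the order of \<open>C(g)\<close>. Cauchy's theorem then yields an element \<open>y\<close> of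
  order \<open>p\<close> commuting with \<open>g\<close>, and \<open>g\<close> is a power of \<open>y\<close>. So \<open>g\<close> itself has order \<open>p\<close>, and its
  centralizer has order \<open>p\<close> like that of \<open>z\<close>.
\<close>

lemma class_size_long_cycle_comparable_imp_eq:
  assumes n: "n \<ge> 3" and p: "prime p" "n \<le> p + 1"
    and z: "z \<in> carrier (sym_group n)" "z \<noteq> id" "z ^^ p = id"
    and g: "g \<in> carrier (sym_group n)" "g \<noteq> id"
    and dvd: "class_size (sym_group n) z dvd class_size (sym_group n) g
      \<or> class_size (sym_group n) g dvd class_size (sym_group n) z"
  shows "class_size (sym_group n) g = class_size (sym_group n) z"
proof -
  let ?c = "\<lambda>g. card (centralizer (sym_group n) g)"
  have cz: "?c z = p"
    by (rule card_centralizer_long_cycle[OF p z])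
  have "p dvd ?c g"
    using dvd
  proof
    assume "class_size (sym_group n) z dvd class_size (sym_group n) g"
    then have "?c g dvd p"
      using cz sym.class_size_dvd_iff[OF _ z(1) g(1)] by simp
    moreover have "?c g \<noteq> 1"
    proof
      assume "?c g = 1"
      moreover have "{id, g} \<subseteq> centralizer (sym_group n) g"
        using g by (simp add: mem_sym_centralizer_iff sym_group_carrier permutes_id)
      ultimately have "id = g"
        by (metis card_1_singletonE insert_subset singletonD)
      then show False
        using g(2) by simp
    qed
    ultimately show ?thesis
      using p(1) prime_nat_iff by auto
  next
    assume "class_size (sym_group n) g dvd class_size (sym_group n) z"
    then show ?thesis
      using cz sym.class_size_dvd_iff[OF _ g(1) z(1)] by simp
  qed
  then obtain y where y: "y \<in> centralizer (sym_group n) g" "y \<noteq> id" "y ^^ p = id"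
    using sym.Cauchy_centralizer[OF finite_sym_group p(1) g(1)] by auto
  have "g \<circ> y = y \<circ> g" "y permutes {1..n}"
    using y(1) by (simp_all add: mem_sym_centralizer_iff)
  then obtain i where i: "g = y ^^ i"
    using commuting_with_long_cycle_is_power[of "{1..n}" p y g] p y g(1)
    by (auto simp: sym_group_carrier)
  then have "g ^^ p = id"
    using y(3) by (metis funpow_mult id_funpow mult.commute)
  then have "?c g = ?c z"
    using card_centralizer_long_cycle[OF p g] cz by simp
  then show ?thesis
    using sym.class_size_dvd_iff[OF finite_sym_group] z(1) g(1) by (simp add: dvd_antisym)
qed

lemma long_cycle_isolated:
  assumes n: "n \<ge> 3" and p: "prime p" "n \<le> p + 1"
    and z: "z \<in> carrier (sym_group n)" "z \<noteq> id" "z ^^ p = id"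
  shows "isolated_vertex (divisibility_graph (sym_group n)) (class_size (sym_group n) z)"
  unfolding isolated_vertex_def divisibility_graph_adjacent_iff
proof (intro conjI ballI impI notI; (elim conjE)?)
  show "class_size (sym_group n) z \<in> verts (divisibility_graph (sym_group n))"
    using mem_verts_iff[OF n z(1)] z(2) by simp
next
  fix w
  assume w: "w \<in> verts (divisibility_graph (sym_group n))" "w \<noteq> class_size (sym_group n) z"
    and dvd: "class_size (sym_group n) z dvd w \<or> w dvd class_size (sym_group n) z"
  obtain g where g: "g \<in> carrier (sym_group n)" "w = class_size (sym_group n) g"
    using w(1) by (auto simp: verts_divisibility_graph)
  then show False
    using class_size_long_cycle_comparable_imp_eq[OF n p z g(1)] w mem_verts_iff[OF n g(1)] dvd
    by auto
qed

lemma cycle_of_list_funpow_length: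
  assumes "distinct cs"
  shows "cycle_of_list cs ^^ length cs = id"
proof
  fix x
  show "(cycle_of_list cs ^^ length cs) x = id x"
  proof (cases "x \<in> set cs")
    case True
    have "map (cycle_of_list cs ^^ length cs) cs = map id cs"
      using cyclic_rotation[OF assms, of "length cs"] by simp
    then show ?thesis
      using True by (metis map_eq_conv)
  next
    case False
    have "(cycle_of_list cs ^^ k) x = x" for k
      using id_outside_supp[OF False] by (induction k) auto
    then show ?thesis by simp
  qed
qed

lemma cycle_of_list_neq_id:
  assumes "distinct cs" "length cs \<ge> 2"
  shows "cycle_of_list cs \<noteq> id"
proof
  assume "cycle_of_list cs = id"
  then have "rotate1 cs = cs"
    using cyclic_rotation[OF assms(1), of 1] by simp
  moreover obtain a b bs where "cs = a # b # bs"
    using assms(2) by (metis One_nat_def Suc_1 Suc_le_length_iff)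
  ultimately show False
    using assms(1) by simp
qed

lemma cycle_of_list_in_sym_group:
  assumes "set cs \<subseteq> {1..n}"
  shows "cycle_of_list cs \<in> carrier (sym_group n)"
  using permutes_subset[OF cycle_permutes assms] by (simp add: sym_group_carrier)

lemma comp_cycle_of_list:
  assumes "distinct cs" "bij f"
  shows "f \<circ> cycle_of_list cs = cycle_of_list (map f cs) \<circ> f"
  using conjugation_of_cycle[OF assms] assms(2)
  by (metis bij_is_inj comp_assoc comp_id inv_o_cancel)

section \<open>Connecting vertices in the divisibility graph of a symmetric group\<close>

interpretation div_sym: graph "divisibility_graph (sym_group n)" for n
  by (rule graph_divisibility_graph) simp

definition linked :: "nat \<Rightarrow> (nat \<Rightarrow> nat) \<Rightarrow> (nat \<Rightarrow> nat) \<Rightarrow> bool" where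
  "linked n g h \<longleftrightarrow> class_size (sym_group n) g
     \<rightarrow>\<^sup>*\<^bsub>divisibility_graph (sym_group n)\<^esub> class_size (sym_group n) h"

lemma linked_sym: "linked n g h \<Longrightarrow> linked n h g"
  unfolding linked_def using div_sym.symmetric_reachable'[of n] by blast

lemma linked_trans: "linked n f g \<Longrightarrow> linked n g h \<Longrightarrow> linked n f h"
  unfolding linked_def by (rule div_sym.reachable_trans)

lemma linked_if_class_size_dvd:
  assumes "n \<ge> 3" "g \<in> carrier (sym_group n)" "g \<noteq> id" "h \<in> carrier (sym_group n)" "h \<noteq> id"
    and "class_size (sym_group n) g dvd class_size (sym_group n) h"
  shows "linked n g h"
proof -
  have V: "class_size (sym_group n) g \<in> verts (divisibility_graph (sym_group n))"
    "class_size (sym_group n) h \<in> verts (divisibility_graph (sym_group n))"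
    using assms mem_verts_iff by blast+
  show ?thesis
  proof (cases "class_size (sym_group n) g = class_size (sym_group n) h")
    case True
    then show ?thesis
      using V div_sym.reachable_refl unfolding linked_def by simp
  next
    case False
    then show ?thesis
      using V assms(6) unfolding linked_def
      by (intro div_sym.reachable_adjI) (simp add: divisibility_graph_adjacent_iff)
  qed
qed

text \<open>
  Both \<open>g\<close> and \<open>h\<close> are powers of \<open>g \<circ> h\<close>, so both class sizes divide that of \<open>g \<circ> h\<close>.
\<close>

lemma linked_if_commute_coprime:
  assumes n: "n \<ge> 3" and g: "g \<in> carrier (sym_group n)" "g \<noteq> id" "g ^^ p = id"
    and h: "h \<in> carrier (sym_group n)" "h \<noteq> id" "h ^^ q = id"
    and comm: "g \<circ> h = h \<circ> g" and "coprime p q"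
  shows "linked n g h"
proof -
  have gh: "g \<circ> h \<in> carrier (sym_group n)"
    using sym.m_closed[OF g(1) h(1)] by simp
  have dvd_g: "class_size (sym_group n) g dvd class_size (sym_group n) (g \<circ> h)"
    using sym.class_size_dvd_coprime_mult[OF finite_sym_group g(1) h(1), of p q] g h comm \<open>coprime p q\<close>
    by simp
  have dvd_h: "class_size (sym_group n) h dvd class_size (sym_group n) (g \<circ> h)"
    using sym.class_size_dvd_coprime_mult[OF finite_sym_group h(1) g(1), of q p] g h comm \<open>coprime p q\<close>
    by (simp add: coprime_commute)
  \<comment> \<open>The class of \<open>g \<circ> h\<close> has more than one element because its size is a multiple of that of \<open>g\<close>.\<close>
  have "g \<circ> h \<noteq> id"
    using dvd_g class_size_eq_1_iff[OF n gh] class_size_eq_1_iff[OF n g(1)] g(2) by auto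
  then show ?thesis
    using linked_if_class_size_dvd[OF n _ _ gh _ dvd_g] linked_if_class_size_dvd[OF n _ _ gh _ dvd_h]
      g h linked_trans linked_sym by blast
qed

text \<open>
  The hypothesis that \<open>z\<close> fixes all the points of the cycle makes the two commute.
\<close>

lemma linked_cycle_of_fixed_points:
  assumes n: "n \<ge> 3" and z: "z \<in> carrier (sym_group n)" "z \<noteq> id" "z ^^ p = id"
    and cs: "distinct cs" "length cs \<ge> 2" "set cs \<subseteq> {1..n}" and fixed: "\<And>x. x \<in> set cs \<Longrightarrow> z x = x"
    and "coprime p (length cs)"
  shows "linked n z (cycle_of_list cs)"
proof (rule linked_if_commute_coprime[OF n z cycle_of_list_in_sym_group[OF cs(3)]
      cycle_of_list_neq_id[OF cs(1,2)] cycle_of_list_funpow_length[OF cs(1)]])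
  have "map z cs = cs"
    using fixed by (simp add: map_idI)
  then show "z \<circ> cycle_of_list cs = cycle_of_list cs \<circ> z"
    using comp_cycle_of_list[OF cs(1) sym_group_permutation(1)[OF z(1)]] by simp
qed fact

lemma obtain_distinct_list:
  assumes "finite A" "k \<le> card A"
  obtains cs where "distinct cs" "length cs = k" "set cs \<subseteq> A"
proof -
  obtain B where B: "B \<subseteq> A" "card B = k" "finite B"
    using obtain_subset_with_card_n[OF assms(2)] assms(1) finite_subset by metis
  then show thesis
    using that finite_distinct_list[of B] distinct_card by metis
qed

text \<open>
  The transposition \<open>(1 2)\<close> serves as base point of the large component.
\<close>

abbreviation anchored :: "nat \<Rightarrow> (nat \<Rightarrow> nat) \<Rightarrow> bool" where
  "anchored n g \<equiv> linked n g (cycle_of_list [1, 2])"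

text \<open>
  At least three of the \<open>n \<ge> 7\<close> points lie outside the two transpositions; a 3-cycle \<open>ds\<close> on them
  is linked to both.
\<close>

lemma anchored_transposition:
  assumes n: "n \<ge> 7" and cs: "distinct cs" "length cs = 2" "set cs \<subseteq> {1..n}"
  shows "anchored n (cycle_of_list cs)"
proof -
  have "card ({1..n} - (set cs \<union> {1, 2})) \<ge> card {1..n} - card (set cs \<union> {1, 2 :: nat})"
    by (rule diff_card_le_card_Diff) simp
  moreover have "card (set cs \<union> {1, 2 :: nat}) \<le> 4"
    using card_Un_le[of "set cs" "{1, 2}"] distinct_card[OF cs(1)] cs(2) by simp
  ultimately have "3 \<le> card ({1..n} - (set cs \<union> {1, 2}))"
    using n by simp
  then obtain ds where ds: "distinct ds" "length ds = 3" "set ds \<subseteq> {1..n} - (set cs \<union> {1, 2})"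
    using obtain_distinct_list[of "{1..n} - (set cs \<union> {1, 2})" 3] by auto
  have link: "linked n (cycle_of_list bs) (cycle_of_list ds)"
    if bs: "distinct bs" "length bs = 2" "set bs \<subseteq> {1..n}" "set bs \<inter> set ds = {}" for bs
  proof (rule linked_cycle_of_fixed_points[where p = 2])
    show "cycle_of_list bs \<in> carrier (sym_group n)" "cycle_of_list bs \<noteq> id"
      using cycle_of_list_in_sym_group[OF bs(3)] cycle_of_list_neq_id[OF bs(1)] bs(2) by simp_all
    show "cycle_of_list bs ^^ 2 = id"
      using cycle_of_list_funpow_length[OF bs(1)] bs(2) by simp
    show "cycle_of_list bs x = x" if "x \<in> set ds" for x
      using that bs(4) by (intro id_outside_supp) auto
  qed (use n ds in auto)
  have "linked n (cycle_of_list cs) (cycle_of_list ds)"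
    using cs ds(3) by (intro link) blast+
  moreover have "anchored n (cycle_of_list ds)"
    using n ds(3) by (intro linked_sym[OF link]) auto
  ultimately show ?thesis
    by (rule linked_trans)
qed

lemma anchored_if_two_fixed_points:
  assumes n: "n \<ge> 7" and z: "z \<in> carrier (sym_group n)" "z \<noteq> id" "z ^^ p = id" and "odd p"
    and two: "2 \<le> card {x \<in> {1..n}. z x = x}"
  shows "anchored n z"
proof -
  obtain cs where cs: "distinct cs" "length cs = 2" "set cs \<subseteq> {x \<in> {1..n}. z x = x}"
    using obtain_distinct_list[OF _ two] by auto
  have "linked n z (cycle_of_list cs)"
    using n z cs \<open>odd p\<close> by (intro linked_cycle_of_fixed_points[where p = p]) auto
  moreover have "anchored n (cycle_of_list cs)"
  proof (rule anchored_transposition[OF n cs(1,2)])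
    show "set cs \<subseteq> {1..n}"
      using cs(3) by blast
  qed
  ultimately show ?thesis
    by (rule linked_trans)
qed

lemma anchored_3_cycle:
  assumes n: "n \<ge> 7" and cs: "distinct cs" "length cs = 3" "set cs \<subseteq> {1..n}"
  shows "anchored n (cycle_of_list cs)"
proof (rule anchored_if_two_fixed_points[OF n, where p = 3])
  have "{1..n} - set cs \<subseteq> {x \<in> {1..n}. cycle_of_list cs x = x}"
    using id_outside_supp by auto
  then have "card ({1..n} - set cs) \<le> card {x \<in> {1..n}. cycle_of_list cs x = x}"
    by (intro card_mono) auto
  then show "2 \<le> card {x \<in> {1..n}. cycle_of_list cs x = x}"
    using n cs distinct_card[OF cs(1)] by (simp add: card_Diff_subset)
qed (use cs cycle_of_list_funpow_length[OF cs(1)] cycle_of_list_neq_id[of cs]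
      cycle_of_list_in_sym_group in auto)

lemma cycle_of_list_3_rotate:
  assumes "distinct [a, b, c]"
  shows "cycle_of_list [b, c, a] = cycle_of_list [a, b, c]"
  using assms by (auto simp: fun_eq_iff transpose_def)

text \<open>
  The factors are swapped by \<open>s\<close>, which exchanges the two supports pointwise, and the second one is
  inverted by the transposition \<open>t\<close>. A permutation \<open>h\<close> commuting with \<open>a \<circ> b\<close> maps the cycle
  \<open>(x, y, w)\<close> to the cycle of \<open>a \<circ> b\<close> that contains \<open>h x\<close>, which is \<open>a\<close> or \<open>b\<close>. So the class size
  of the 3-cycle \<open>a\<close> divides that of \<open>a \<circ> b\<close>.
\<close>

lemma anchored_double_3_cycle:
  assumes n: "n \<ge> 7" and dist: "distinct [x, y, w, x', y', w']"
    and mem: "set [x, y, w, x', y', w'] \<subseteq> {1..n}"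
  shows "anchored n (cycle_of_list [x, y, w] \<circ> cycle_of_list [x', y', w'])"
proof -
  define a b where "a = cycle_of_list [x, y, w]" and "b = cycle_of_list [x', y', w']"
  define s where "s = transpose x x' \<circ> (transpose y y' \<circ> transpose w w')"
  define t where "t = transpose x' y'"
  have a: "a \<in> carrier (sym_group n)" and b: "b \<in> carrier (sym_group n)"
    and s: "s \<in> carrier (sym_group n)" and t: "t \<in> carrier (sym_group n)"
    using mem unfolding a_def b_def s_def t_def sym_group_carrier
    by (auto intro!: permutes_compose permutes_swap_id simp del: cycle_of_list.simps
        intro: permutes_subset[OF cycle_permutes])
  have ab: "a \<circ> b \<in> carrier (sym_group n)"
    using sym.m_closed[OF a b] by simp
  have rot: "a x = y" "a y = w" "a w = x" "b x' = y'" "b y' = w'" "b w' = x'"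
    "a x' = x'" "a y' = y'" "a w' = w'" "b x = x" "b y = y" "b w = w"
    using dist by (auto simp: a_def b_def)
  have comm: "a \<circ> b = b \<circ> a"
    unfolding a_def b_def using dist by (intro cycles_commute) auto
  have cycles: "cycle_of_list [x, y, w] = a" "cycle_of_list [y, w, x] = a" "cycle_of_list [w, x, y] = a"
    "cycle_of_list [x', y', w'] = b" "cycle_of_list [y', w', x'] = b" "cycle_of_list [w', x', y'] = b"
    using dist cycle_of_list_3_rotate[of x y w] cycle_of_list_3_rotate[of y w x]
      cycle_of_list_3_rotate[of x' y' w'] cycle_of_list_3_rotate[of y' w' x']
    unfolding a_def b_def by (auto simp del: cycle_of_list.simps)
  have "bij s" "bij t"
    using s t sym_group_permutation(1) by blast+
  note conj = comp_cycle_of_list[OF _ this(1)] comp_cycle_of_list[OF _ this(2)]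
  have sa: "s \<circ> a = b \<circ> s" and sb: "s \<circ> b = a \<circ> s"
    using conj(1)[of "[x, y, w]"] conj(1)[of "[x', y', w']"] dist
    by (auto simp: s_def a_def b_def simp del: cycle_of_list.simps)
  have ta: "t \<circ> a = a \<circ> t"
    using conj(2)[of "[x, y, w]"] dist
    by (auto simp: t_def a_def simp del: cycle_of_list.simps)
  have tb: "t \<circ> b = cycle_of_list [y', x', w'] \<circ> t"
    using conj(2)[of "[x', y', w']"] dist
    by (auto simp: t_def b_def simp del: cycle_of_list.simps)
  have "cycle_of_list [y', x', w'] \<circ> b = id"
    using dist by (auto simp: b_def fun_eq_iff transpose_def)
  then have inv_b: "inv' b = cycle_of_list [y', x', w']"
    using sym_group_permutation(1)[OF b] by (metis bij_is_surj comp_assoc comp_id id_comp surj_iff)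
  have "class_size (sym_group n) a dvd class_size (sym_group n) (a \<circ> b)"
  proof -
    have "a \<noteq> b" "b \<circ> b \<noteq> id"
      using rot dist by (auto simp: fun_eq_iff) metis+
    moreover have "h \<circ> a \<circ> inv' h \<in> {a, b}" if h: "h \<in> centralizer (sym_group n) (a \<circ> b)" for h
    proof -
      have h': "h permutes {1..n}" and hab: "h \<circ> (a \<circ> b) = a \<circ> b \<circ> h"
        using h by (simp_all add: mem_sym_centralizer_iff)
      have app: "h (a (b v)) = a (b (h v))" for v
        using fun_cong[OF hab, of v] by simp
      have hy: "h y = a (b (h x))" and hw: "h w = a (b (h y))"
        using app[of x] app[of y] rot by simp_all
      have "h y \<noteq> h x"
        using dist permutes_inj[OF h'] by (auto simp: inj_eq)
      then have "a (b (h x)) \<noteq> h x"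
        using hy by simp
      have "h x \<in> {x, y, w, x', y', w'}"
      proof (rule ccontr)
        assume "h x \<notin> {x, y, w, x', y', w'}"
        then have "a (h x) = h x" "b (h x) = h x"
          unfolding a_def b_def by (intro id_outside_supp; simp)+
        then show False
          using \<open>a (b (h x)) \<noteq> h x\<close> by simp
      qed
      moreover have "h \<circ> a \<circ> inv' h = cycle_of_list [h x, h y, h w]"
        using conjugation_of_cycle[of "[x, y, w]" h] permutes_bij[OF h'] dist
        by (simp add: a_def del: cycle_of_list.simps)
      ultimately show ?thesis
        by (elim insertE emptyE) (simp_all add: hy hw rot cycles del: cycle_of_list.simps)
    qed
    ultimately show ?thesis
      using sym.class_size_dvd_of_swapped_factors[OF finite_sym_group a b _ _ _ s _ _ t]
        comm sa sb ta tb inv_b b by (simp add: centralizer_def)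
  qed
  moreover have "a \<noteq> id" "a \<circ> b \<noteq> id"
    using rot dist by (auto simp: fun_eq_iff) metis+
  ultimately have "linked n a (a \<circ> b)"
    using n a ab by (intro linked_if_class_size_dvd) auto
  moreover have "anchored n a"
    unfolding a_def using dist mem by (intro anchored_3_cycle[OF n]) auto
  ultimately show ?thesis
    unfolding a_def b_def by (blast intro: linked_sym linked_trans)
qed

text \<open>
  Either there are three fixed points, which carry a 3-cycle commuting with \<open>z\<close>, or at least five
  points are moved, hence three 2-cycles \<open>(x, z x)\<close>, \<open>(y, z y)\<close>, \<open>(w, z w)\<close>. In that case \<open>z\<close>
  exchanges the 3-cycles \<open>a = (x, y, w)\<close> and \<open>b = (z x, z y, z w)\<close> and commutes with their product,
  which has order 3.
\<close>

lemma anchored_involution: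
  assumes n: "n \<ge> 7" and z: "z \<in> carrier (sym_group n)" "z \<noteq> id" "z \<circ> z = id"
  shows "anchored n z"
proof (cases "3 \<le> card {x \<in> {1..n}. z x = x}")
  case True
  obtain cs where cs: "distinct cs" "length cs = 3" "set cs \<subseteq> {x \<in> {1..n}. z x = x}"
    using obtain_distinct_list[OF _ True] by auto
  have "z ^^ 2 = id"
    using z(3) by (simp add: numeral_2_eq_2)
  then have "linked n z (cycle_of_list cs)"
    using n z cs by (intro linked_cycle_of_fixed_points[where p = 2]) auto
  moreover have "anchored n (cycle_of_list cs)"
  proof (rule anchored_3_cycle[OF n cs(1,2)])
    show "set cs \<subseteq> {1..n}"
      using cs(3) by blast
  qed
  ultimately show ?thesis
    by (rule linked_trans)
next
  case False
  let ?M = "{x \<in> {1..n}. z x \<noteq> x}"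
  have z': "z permutes {1..n}"
    using z(1) by (simp add: sym_group_carrier)
  have zz: "z (z v) = v" for v
    using fun_cong[OF z(3), of v] by simp
  have inj: "z u = z v \<longleftrightarrow> u = v" for u v
    using permutes_inj[OF z'] by (simp add: inj_eq)
  have "{x \<in> {1..n}. z x = x} \<union> ?M = {1..n}"
    by auto
  then have "card {x \<in> {1..n}. z x = x} + card ?M = card {1..n}"
    by (subst card_Un_disjoint[symmetric]) auto
  then have M: "card ?M \<ge> 5"
    using False n by simp
  have outside: "\<exists>v. v \<in> ?M \<and> v \<notin> set vs" if "length vs < 5" for vs :: "nat list"
  proof (rule ccontr)
    assume "\<not> ?thesis"
    then have "card ?M \<le> card (set vs)"
      by (intro card_mono) auto
    then show False
      using M that card_length[of vs] by simp
  qed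
  obtain x where x: "x \<in> ?M"
    using outside[of "[]"] by auto
  obtain y where y: "y \<in> ?M" "y \<notin> set [x, z x]"
    using outside[of "[x, z x]"] by auto
  obtain w where w: "w \<in> ?M" "w \<notin> set [x, z x, y, z y]"
    using outside[of "[x, z x, y, z y]"] by auto
  define a b where "a = cycle_of_list [x, y, w]" and "b = cycle_of_list [z x, z y, z w]"
  have dist: "distinct [x, y, w, z x, z y, z w]"
    using x y w zz by (simp add: inj) metis
  have mem: "set [x, y, w, z x, z y, z w] \<subseteq> {1..n}"
    using x y w permutes_in_image[OF z'] by auto
  have a: "a \<in> carrier (sym_group n)" and b: "b \<in> carrier (sym_group n)"
    unfolding a_def b_def using mem by (intro cycle_of_list_in_sym_group; simp)+
  have pow: "a ^^ 3 = id" "b ^^ 3 = id"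
    using cycle_of_list_funpow_length[of "[x, y, w]"] cycle_of_list_funpow_length[of "[z x, z y, z w]"] dist
    unfolding a_def b_def by (simp_all add: numeral_3_eq_3 del: cycle_of_list.simps)
  have comm: "a \<circ> b = b \<circ> a"
    unfolding a_def b_def using dist by (intro cycles_commute) auto
  have ab: "a \<circ> b \<in> carrier (sym_group n)"
    using sym.m_closed[OF a b] by simp
  have ab3: "(a \<circ> b) ^^ 3 = id"
    using sym.pow_mult_distrib[OF _ a b, of 3] comm pow by simp
  have "z \<circ> a = b \<circ> z" "z \<circ> b = a \<circ> z"
    using comp_cycle_of_list[of "[x, y, w]" z] comp_cycle_of_list[of "[z x, z y, z w]" z]
      permutes_bij[OF z'] dist zz unfolding a_def b_def
    by (simp_all del: cycle_of_list.simps)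
  then have zab: "z \<circ> (a \<circ> b) = a \<circ> b \<circ> z"
    using comm by (metis comp_assoc)
  have "(a \<circ> b) x = y"
    using dist by (auto simp: a_def b_def)
  moreover have "x \<noteq> y"
    using dist by simp
  ultimately have "a \<circ> b \<noteq> id"
    by (metis id_apply)
  moreover have "z ^^ 2 = id"
    using z(3) by (simp add: numeral_2_eq_2)
  ultimately have "linked n z (a \<circ> b)"
    using n z ab ab3 zab by (intro linked_if_commute_coprime[where p = 2 and q = 3]) auto
  moreover have "anchored n (a \<circ> b)"
    unfolding a_def b_def by (rule anchored_double_3_cycle[OF n dist mem])
  ultimately show ?thesis
    by (rule linked_trans)
qed

text \<open>
  The involution maps \<open>(z ^^ i) x\<close> to \<open>(z ^^ i) y\<close> and back. This is well defined because the two
  orbits have the same length \<open>p\<close>, and it commutes with \<open>z\<close> by construction.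
\<close>

lemma orbit_swapping_involution:
  assumes z: "z permutes S" "finite S" and p: "prime p" "z ^^ p = id"
    and x: "z x \<noteq> x" and y: "z y \<noteq> y" "y \<notin> funpow_orbit z x"
  obtains t where "t permutes S" "t \<noteq> id" "t \<circ> t = id" "z \<circ> t = t \<circ> z"
proof -
  have perm: "permutation z"
    using z permutation_permutes by blast
  note iff_x = funpow_eq_iff_mod_prime[OF perm p x] and iff_y = funpow_eq_iff_mod_prime[OF perm p y(1)]
  let ?X = "funpow_orbit z x" and ?Y = "funpow_orbit z y"
  have disj: "(z ^^ i) x \<noteq> (z ^^ j) y" for i j
  proof
    assume eq: "(z ^^ i) x = (z ^^ j) y"
    \<comment> \<open>As \<open>z\<close> has order \<open>p\<close>, the power \<open>z ^^ (j * (p - 1))\<close> is the inverse of \<open>z ^^ j\<close>.\<close>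
    have "j * (p - 1) + j = j * p"
      using prime_gt_0_nat[OF p(1)] by (cases p) auto
    then have "(z ^^ (j * (p - 1) + j)) y = y"
      using iff_y[of "j * (p - 1) + j" 0] by simp
    then have "y = (z ^^ (j * (p - 1))) ((z ^^ j) y)"
      by (simp only: funpow_add comp_apply)
    also have "\<dots> = (z ^^ (j * (p - 1) + i)) x"
      by (simp add: funpow_add flip: eq)
    finally show False
      using y(2) by blast
  qed
  \<comment> \<open>The index chosen for \<open>v\<close> is determined modulo \<open>p\<close> only, which does not affect the value.\<close>
  define t where "t v = (if v \<in> ?X then (z ^^ (SOME i. v = (z ^^ i) x)) y
      else if v \<in> ?Y then (z ^^ (SOME i. v = (z ^^ i) y)) x else v)" for v
  have tx: "t ((z ^^ i) x) = (z ^^ i) y" for i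
  proof -
    have "(z ^^ i) x = (z ^^ (SOME j. (z ^^ i) x = (z ^^ j) x)) x"
      by (rule someI) (rule refl)
    then have "(z ^^ (SOME j. (z ^^ i) x = (z ^^ j) x)) y = (z ^^ i) y"
      unfolding iff_x iff_y by simp
    then show ?thesis
      by (simp add: t_def)
  qed
  have ty: "t ((z ^^ i) y) = (z ^^ i) x" for i
  proof -
    have "(z ^^ i) y = (z ^^ (SOME j. (z ^^ i) y = (z ^^ j) y)) y"
      by (rule someI) (rule refl)
    then have "(z ^^ (SOME j. (z ^^ i) y = (z ^^ j) y)) x = (z ^^ i) x"
      unfolding iff_x iff_y by simp
    moreover have "(z ^^ i) y \<notin> ?X"
      using disj[symmetric] by (auto simp: image_iff)
    ultimately show ?thesis
      by (simp add: t_def)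
  qed
  have t_other: "t v = v" if "v \<notin> ?X" "v \<notin> ?Y" for v
    using that by (simp add: t_def)
  have cases: "(\<exists>i. v = (z ^^ i) x) \<or> (\<exists>i. v = (z ^^ i) y) \<or> (v \<notin> ?X \<and> v \<notin> ?Y)" for v
    by (auto simp: image_iff)
  have tt: "t (t v) = v" for v
    using cases[of v] by (elim disjE exE) (simp_all add: tx ty t_other)
  have zX: "z v \<in> funpow_orbit z u \<longleftrightarrow> v \<in> funpow_orbit z u" for u v
  proof
    assume "v \<in> funpow_orbit z u"
    then obtain i where "v = (z ^^ i) u" by blast
    then have "z v = (z ^^ Suc i) u" by simp
    then show "z v \<in> funpow_orbit z u" by blast
  next
    assume "z v \<in> funpow_orbit z u"
    then obtain i where i: "z v = (z ^^ i) u" by blast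
    have "(z ^^ (p - 1)) (z v) = v"
      using p prime_gt_0_nat[OF p(1)] by (metis Suc_diff_1 comp_apply funpow_Suc_right id_apply)
    then have "v = (z ^^ (p - 1 + i)) u"
      using i by (simp add: funpow_add)
    then show "v \<in> funpow_orbit z u" by blast
  qed
  have zt: "z (t v) = t (z v)" for v
  proof -
    consider i where "v = (z ^^ i) x" | i where "v = (z ^^ i) y" | "v \<notin> ?X" "v \<notin> ?Y"
      using cases[of v] by blast
    then show ?thesis
    proof cases
      case 1
      then show ?thesis
        using tx[of i] tx[of "Suc i"] by simp
    next
      case 2
      then show ?thesis
        using ty[of i] ty[of "Suc i"] by simp
    next
      case 3
      then have "z v \<notin> ?X" "z v \<notin> ?Y"
        using zX by blast+
      then show ?thesis
        using 3 t_other by simp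
    qed
  qed
  show thesis
  proof
    have "?X \<subseteq> S" "?Y \<subseteq> S"
      using funpow_orbit_subset[OF z(1)] moved_in_permutes[OF z(1)] x y(1) by blast+
    then have "t v = v" if "v \<notin> S" for v
      using that t_other by blast
    moreover have "\<exists>!u. t u = v" for v
      using tt by metis
    ultimately show "t permutes S"
      by (simp add: permutes_def)
    have "x \<noteq> y"
      using disj[of 0 0] by simp
    then have "t x \<noteq> x"
      using tx[of 0] by simp
    then show "t \<noteq> id" by auto
    show "t \<circ> t = id" "z \<circ> t = t \<circ> z"
      using tt zt by (auto simp: fun_eq_iff)
  qed
qed

text \<open>
  Take the orbit of a moved point. If a second nontrivial orbit exists, \<open>z\<close> commutes with an
  involution swapping the two; otherwise the \<open>n - p \<ge> 2\<close> points outside the orbit are all fixed.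
\<close>

lemma anchored_odd_prime:
  assumes n: "n \<ge> 7" and z: "z \<in> carrier (sym_group n)" "z \<noteq> id" "z ^^ p = id"
    and p: "prime p" "odd p" "p + 2 \<le> n"
  shows "anchored n z"
proof -
  have z': "z permutes {1..n}"
    using z(1) by (simp add: sym_group_carrier)
  have perm: "permutation z"
    by (rule sym_group_permutation(3)[OF z(1)])
  obtain x where x: "z x \<noteq> x"
    using z(2) by (auto simp: fun_eq_iff)
  let ?O = "funpow_orbit z x"
  have O: "?O \<subseteq> {1..n}" "card ?O = p"
    using funpow_orbit_subset[OF z' moved_in_permutes[OF z' x]] funpow_orbit_prime(2)[OF perm p(1) z(3) x]
    by auto
  show ?thesis
  proof (cases "\<exists>y. z y \<noteq> y \<and> y \<notin> ?O")
    case True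
    then obtain y where y: "z y \<noteq> y" "y \<notin> ?O" by blast
    obtain t where t: "t permutes {1..n}" "t \<noteq> id" "t \<circ> t = id" "z \<circ> t = t \<circ> z"
      using orbit_swapping_involution[OF z' _ p(1) z(3) x y] by blast
    have t': "t \<in> carrier (sym_group n)"
      using t(1) by (simp add: sym_group_carrier)
    have "t ^^ 2 = id"
      using t(3) by (simp add: numeral_2_eq_2)
    then have "linked n z t"
      using n z t t' p by (intro linked_if_commute_coprime[where p = p and q = 2]) auto
    moreover have "anchored n t"
      by (rule anchored_involution[OF n t' t(2,3)])
    ultimately show ?thesis
      by (rule linked_trans)
  next
    case False
    then have "{1..n} - ?O \<subseteq> {x \<in> {1..n}. z x = x}"
      by auto
    then have "card ({1..n} - ?O) \<le> card {x \<in> {1..n}. z x = x}"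
      by (intro card_mono) auto
    moreover have "card ({1..n} - ?O) \<ge> 2"
      using O p(3) by (simp add: card_Diff_subset finite_subset)
    ultimately show ?thesis
      using n z p(2) by (intro anchored_if_two_fixed_points[where p = p]) auto
  qed
qed

text \<open>
  Take \<open>k = ord g / p\<close> for a prime divisor \<open>p\<close> of the order of \<open>g\<close>.
\<close>

lemma obtain_prime_order_power:
  assumes g: "g \<in> carrier (sym_group n)" "g \<noteq> id"
  obtains p k where "prime p" "g ^^ k \<noteq> id" "(g ^^ k) ^^ p = id"
proof -
  let ?m = "group.ord (sym_group n) g"
  have pow: "g ^^ k = id \<longleftrightarrow> ?m dvd k" for k
    using sym.pow_eq_id[OF g(1), of k] by simp
  have "?m \<noteq> 1"
    using pow[of 1] g(2) by auto
  then obtain p where p: "prime p" "p dvd ?m"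
    using prime_factor_nat by blast
  then obtain k where k: "?m = p * k" by blast
  have "?m > 0"
    using sym.ord_ge_1[OF _ g(1)] by simp
  then have "\<not> ?m dvd k"
    using k p(1) prime_gt_1_nat[of p] by (auto dest!: dvd_imp_le)
  then have "g ^^ k \<noteq> id" "(g ^^ k) ^^ p = id"
    using pow[of k] pow[of "k * p"] k by (auto simp: funpow_mult mult.commute)
  then show thesis
    using that p(1) by blast
qed

text \<open>
  Some power \<open>z\<close> of \<open>g\<close> has prime order \<open>p\<close>, and \<open>g\<close> is linked to it. If \<open>p \<le> n - 2\<close>, then \<open>z\<close>
  is anchored. Otherwise \<open>g\<close> commutes with \<open>z\<close> and is therefore a power of it, so the
  centralizer of \<open>g\<close> has order \<open>p\<close>. The same is true of the cycle \<open>(1 2 ... p)\<close>, and the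
  class sizes agree.
\<close>

lemma anchored_or_long_cycle_class_size:
  assumes n: "n \<ge> 7" and g: "g \<in> carrier (sym_group n)" "g \<noteq> id"
  shows "anchored n g \<or> (\<exists>\<delta> p. class_size (sym_group n) g = class_size (sym_group n) \<delta> \<and>
    prime p \<and> n - 1 \<le> p \<and> \<delta> \<in> carrier (sym_group n) \<and> is_cycle_of_length p \<delta>)"
proof -
  obtain p k where p: "prime p" and z: "g ^^ k \<noteq> id" "(g ^^ k) ^^ p = id"
    using obtain_prime_order_power[OF g] by blast
  have g': "g permutes {1..n}"
    using g(1) by (simp add: sym_group_carrier)
  then have zG: "g ^^ k \<in> carrier (sym_group n)"
    by (simp add: sym_group_carrier permutes_funpow)
  have "class_size (sym_group n) (g ^^ k) dvd class_size (sym_group n) g"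
    using sym.class_size_pow_dvd[OF finite_sym_group g(1), of k] by simp
  then have link: "linked n g (g ^^ k)"
    using n g z zG by (intro linked_sym[OF linked_if_class_size_dvd]) auto
  show ?thesis
  proof (cases "p + 2 \<le> n")
    case True
    have "anchored n (g ^^ k)"
    proof (cases "odd p")
      case True
      then show ?thesis
        using anchored_odd_prime[OF n zG z p] \<open>p + 2 \<le> n\<close> by blast
    next
      case False
      then have "p = 2"
        using p prime_odd_nat prime_ge_2_nat by (metis le_neq_implies_less)
      then show ?thesis
        using anchored_involution[OF n zG z(1)] z(2) by (simp add: numeral_2_eq_2)
    qed
    then show ?thesis
      using link linked_trans by blast
  next
    case False
    then have np: "n \<le> p + 1" by simp
    obtain x where x: "(g ^^ k) x \<noteq> x"
      using z(1) by (auto simp: fun_eq_iff)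
    have zS: "g ^^ k permutes {1..n}"
      using zG by (simp add: sym_group_carrier)
    have "funpow_orbit (g ^^ k) x \<subseteq> {1..n}"
      by (rule funpow_orbit_subset[OF zS moved_in_permutes[OF zS x]])
    then have "p \<le> n"
      using funpow_orbit_prime(2)[OF sym_group_permutation(3)[OF zG] p z(2) x]
        card_mono[of "{1..n}" "funpow_orbit (g ^^ k) x"] by simp
    have "g \<circ> g ^^ k = g ^^ k \<circ> g"
      by (simp add: fun_eq_iff funpow_swap1)
    then obtain i where "g = (g ^^ k) ^^ i"
      using commuting_with_long_cycle_is_power[OF _ _ zS p z(2,1) g'] np by auto
    then have gp: "g ^^ p = id"
      using z(2) by (metis funpow_mult id_funpow mult.commute)
    define cs where "cs = [1..<p + 1]"
    have cs: "distinct cs" "length cs = p" "set cs \<subseteq> {1..n}"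
      using \<open>p \<le> n\<close> by (auto simp: cs_def)
    note \<delta> = cycle_of_list_in_sym_group[OF cs(3)]
    have "card (centralizer (sym_group n) (cycle_of_list cs)) = p"
      using card_centralizer_long_cycle[OF p np \<delta>] cycle_of_list_neq_id[OF cs(1)]
        cycle_of_list_funpow_length[OF cs(1)] cs(2) prime_ge_2_nat[OF p] by simp
    moreover have "card (centralizer (sym_group n) g) = p"
      by (rule card_centralizer_long_cycle[OF p np g gp])
    ultimately have "class_size (sym_group n) g = class_size (sym_group n) (cycle_of_list cs)"
      using sym.class_size_dvd_iff[OF finite_sym_group] g(1) \<delta> by (simp add: dvd_antisym)
    moreover have "is_cycle_of_length p (cycle_of_list cs)"
      using cs by (auto simp: is_cycle_of_length_def)
    ultimately show ?thesis
      using p np \<delta> by (metis le_diff_conv)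
  qed
qed

theorem theorem10:
  fixes n :: nat
  assumes "n > 6"
  shows "(\<forall>(p::nat) \<delta>. prime p \<and> p \<ge> n - 1 \<and> \<delta> \<in> carrier (sym_group n) \<and>
            \<delta> \<noteq> \<one>\<^bsub>sym_group n\<^esub> \<and> is_cycle_of_length p \<delta> \<longrightarrow>
          isolated_vertex (divisibility_graph (sym_group n)) (class_size (sym_group n) \<delta>)) \<and>
    (\<exists>C \<in> pre_digraph.sccs (divisibility_graph (sym_group n)).
       verts (divisibility_graph (sym_group n)) -
         {class_size (sym_group n) \<delta> | \<delta> (p::nat). prime p \<and> p \<ge> n - 1 \<and>
            \<delta> \<in> carrier (sym_group n) \<and> is_cycle_of_length p \<delta>}
       \<subseteq> verts C)"
proof (intro conjI allI impI)
  fix p :: nat and \<delta>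
  assume asm: "prime p \<and> p \<ge> n - 1 \<and> \<delta> \<in> carrier (sym_group n) \<and>
    \<delta> \<noteq> \<one>\<^bsub>sym_group n\<^esub> \<and> is_cycle_of_length p \<delta>"
  then have "\<delta> ^^ p = id"
    using cycle_of_list_funpow_length by (auto simp: is_cycle_of_length_def)
  then show "isolated_vertex (divisibility_graph (sym_group n)) (class_size (sym_group n) \<delta>)"
    using asm \<open>n > 6\<close> by (intro long_cycle_isolated[where p = p]) auto
next
  let ?D = "divisibility_graph (sym_group n)"
  let ?bad = "{class_size (sym_group n) \<delta> | \<delta> (p::nat). prime p \<and> p \<ge> n - 1 \<and>
            \<delta> \<in> carrier (sym_group n) \<and> is_cycle_of_length p \<delta>}"
  let ?v = "class_size (sym_group n) (cycle_of_list [1, 2])"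
  let ?W = "{w. ?v \<rightarrow>\<^sup>*\<^bsub>?D\<^esub> w}"
  have n: "n \<ge> 7"
    using assms by simp
  have "?v \<in> verts ?D"
    using n mem_verts_iff[OF _ cycle_of_list_in_sym_group[of "[1, 2]" n]] cycle_of_list_neq_id[of "[1, 2 :: nat]"]
    by (simp del: cycle_of_list.simps)
  then have "?D \<restriction> ?W \<in> pre_digraph.sccs ?D"
    by (rule div_sym.induce_reachable_is_in_sccs)
  moreover have "verts ?D - ?bad \<subseteq> verts (?D \<restriction> ?W)"
  proof
    fix w
    assume w: "w \<in> verts ?D - ?bad"
    then obtain g where g: "g \<in> carrier (sym_group n)" "w = class_size (sym_group n) g"
      by (auto simp: verts_divisibility_graph)
    have "g \<noteq> id"
      using w mem_verts_iff[OF _ g(1)] n g(2) by auto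
    then have "anchored n g"
      using anchored_or_long_cycle_class_size[OF n g(1)] w g(2) by blast
    then show "w \<in> verts (?D \<restriction> ?W)"
      using linked_sym g(2) unfolding linked_def by (simp add: induce_subgraph_verts)
  qed
  ultimately show "\<exists>C \<in> pre_digraph.sccs ?D. verts ?D - ?bad \<subseteq> verts C"
    by blast
qed

end
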